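(* Let $\operatorname{Dias}$ be the non-symmetric diassociative operad over $\mathbb{Q}$. Let $\tau_1$ be multiplication by $-1$ on $\operatorname{Dias}(1)$ and let $\tau_2$ be the endomorphism of $\operatorname{Dias}(2)$ given by $\tau_2(x_1\dashv x_2)=-\,x_1\vdash x_2$ and $\tau_2(x_1\vdash x_2)=x_1\dashv x_2-x_1\vdash x_2$. Then there exists a unique collection $\tau=(\tau_n)_{n\ge 1}$ of endomorphisms $\tau_n$ of the spaces $\operatorname{Dias}(n)$ which extends $\tau_1$ and $\tau_2$ and endows the operad $\operatorname{Dias}$ with a structure of non-symmetric anticyclic operad.
   Context: All vector spaces are over $\mathbb{Q}$. The non-symmetric operad $\operatorname{Dias}$ is generated by two binary operations $x\dashv y$ and $x\vdash y$ subject to the relations $x\dashv(y\vdash z)=x\dashv(y\dashv z)=(x\dashv y)\dashv z$, $x\vdash(y\dashv z)=(x\vdash y)\dashv z$, $x\vdash(y\vdash z)=(x\vdash y)\vdash z=(x\dashv y)\vdash z$. A non-symmetric anticyclic operad is a non-symmetric operad $\mathcal{P}$ (with unit $1\in\mathcal{P}(1)$ and partial compositions $\circ_i$) together with endomorphisms $\tau_n$ of $\mathcal{P}(n)$, $n\ge1$, such that $\tau_n^{n+1}=\mathrm{Id}$ (an action of the cyclic group of order $n+1$ on $\mathcal P(n)$), $\tau_1(1)=-1$, and for $f\in\mathcal{P}(m)$, $g\in\mathcal{P}(n)$: $\tau_{m+n-1}(f\circ_i g)=\tau_m(f)\circ_{i-1}g$ for $2\le i\le m$, and $\tau_{m+n-1}(f\circ_1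 g)=-\tau_n(g)\circ_n\tau_m(f)$. The map $\tau_2$ is the one obtained from the rule $\langle E(x,y),z\rangle=\langle\tau_2(E)(y,z),x\rangle$ for an antisymmetric bilinear map $\langle\,,\rangle$ satisfying $\langle x\dashv y,z\rangle=-\langle y\vdash z,x\rangle$ and $\langle x\vdash y,z\rangle=\langle y\dashv z,x\rangle-\langle y\vdash z,x\rangle$. *)

theory Defs
  imports Complex_Main "HOL-Library.Poly_Mapping" "HOL-Library.FuncSet"
begin

section \<open>Non-symmetric (anticyclic) operads over the rationals\<close>

text \<open>
  The spaces \<open>P n\<close> (\<open>n \<ge> 1\<close>) are subspaces of one ambient vector space, which one may think of
  as the direct sum of all of them; \<open>comp f i g\<close> is the partial composition \<open>f \<circ>\<^sub>i g\<close>, and inputs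
  are numbered from 1. All axioms are relativised to the \<open>P n\<close> and to indices in range; the values
  of \<open>P\<close> at 0 and of \<open>comp\<close> outside these ranges are irrelevant.
\<close>

locale ns_operad = vector_space scale
  for scale :: "rat \<Rightarrow> 'a::ab_group_add \<Rightarrow> 'a" +
  fixes P :: "nat \<Rightarrow> 'a set"
    and unit :: 'a
    and comp :: "'a \<Rightarrow> nat \<Rightarrow> 'a \<Rightarrow> 'a"
  assumes subspace_P: "1 \<le> n \<Longrightarrow> subspace (P n)"
    and unit_in: "unit \<in> P 1"
    and comp_in: "\<lbrakk>1 \<le> i; i \<le> m; 1 \<le> n; f \<in> P m; g \<in> P n\<rbrakk> \<Longrightarrow> comp f i g \<in> P (m + n - 1)"
    and comp_add_left: "\<lbrakk>1 \<le> i; i \<le> m; 1 \<le> n; f \<in> P m; f' \<in> P m; g \<in> P n\<rbrakk>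
      \<Longrightarrow> comp (f + f') i g = comp f i g + comp f' i g"
    and comp_add_right: "\<lbrakk>1 \<le> i; i \<le> m; 1 \<le> n; f \<in> P m; g \<in> P n; g' \<in> P n\<rbrakk>
      \<Longrightarrow> comp f i (g + g') = comp f i g + comp f i g'"
    and comp_scale_left: "\<lbrakk>1 \<le> i; i \<le> m; 1 \<le> n; f \<in> P m; g \<in> P n\<rbrakk>
      \<Longrightarrow> comp (scale c f) i g = scale c (comp f i g)"
    and comp_scale_right: "\<lbrakk>1 \<le> i; i \<le> m; 1 \<le> n; f \<in> P m; g \<in> P n\<rbrakk>
      \<Longrightarrow> comp f i (scale c g) = scale c (comp f i g)"
    and unit_left: "\<lbrakk>1 \<le> n; g \<in> P n\<rbrakk> \<Longrightarrow> comp unit 1 g = g"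
    and unit_right: "\<lbrakk>1 \<le> i; i \<le> m; f \<in> P m\<rbrakk> \<Longrightarrow> comp f i unit = f"
    and comp_sequential: "\<lbrakk>1 \<le> i; i \<le> l; 1 \<le> j; j \<le> m; 1 \<le> n; f \<in> P l; g \<in> P m; h \<in> P n\<rbrakk>
      \<Longrightarrow> comp (comp f i g) (i - 1 + j) h = comp f i (comp g j h)"
    and comp_parallel: "\<lbrakk>1 \<le> i; i < k; k \<le> l; 1 \<le> m; 1 \<le> n; f \<in> P l; g \<in> P m; h \<in> P n\<rbrakk>
      \<Longrightarrow> comp (comp f i g) (k - 1 + m) h = comp (comp f k h) i g"

locale ns_anticyclic_operad = ns_operad scale P unit comp
  for scale :: "rat \<Rightarrow> 'a::ab_group_add \<Rightarrow> 'a"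
    and P :: "nat \<Rightarrow> 'a set"
    and unit :: 'a
    and comp :: "'a \<Rightarrow> nat \<Rightarrow> 'a \<Rightarrow> 'a" +
  fixes \<tau> :: "nat \<Rightarrow> 'a \<Rightarrow> 'a"
  assumes tau_in: "\<lbrakk>1 \<le> n; f \<in> P n\<rbrakk> \<Longrightarrow> \<tau> n f \<in> P n"
    and tau_add: "\<lbrakk>1 \<le> n; f \<in> P n; g \<in> P n\<rbrakk> \<Longrightarrow> \<tau> n (f + g) = \<tau> n f + \<tau> n g"
    and tau_scale: "\<lbrakk>1 \<le> n; f \<in> P n\<rbrakk> \<Longrightarrow> \<tau> n (scale c f) = scale c (\<tau> n f)"
    and tau_cyclic: "\<lbrakk>1 \<le> n; f \<in> P n\<rbrakk> \<Longrightarrow> (\<tau> n ^^ (n + 1)) f = f"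
    and tau_unit: "\<tau> 1 unit = - unit"
    and tau_comp: "\<lbrakk>2 \<le> i; i \<le> m; 1 \<le> n; f \<in> P m; g \<in> P n\<rbrakk>
      \<Longrightarrow> \<tau> (m + n - 1) (comp f i g) = comp (\<tau> m f) (i - 1) g"
    and tau_comp_first: "\<lbrakk>1 \<le> m; 1 \<le> n; f \<in> P m; g \<in> P n\<rbrakk>
      \<Longrightarrow> \<tau> (m + n - 1) (comp f 1 g) = - comp (\<tau> n g) n (\<tau> m f)"


section \<open>The free non-symmetric operad on two binary operations\<close>

text \<open>Planar binary trees with inner vertices labelled by one of the two operations, that is,
  the monomials in which each of the variables \<open>x\<^sub>1, ..., x\<^sub>n\<close> occurs once and in this order.\<close>

datatype dtree =
    Leaf
  | LeftProd dtree dtree  (infix \<open>\<stileturn>\<close> 70)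
  | RightProd dtree dtree  (infix \<open>\<turnstile>\<close> 70)

fun leaves :: "dtree \<Rightarrow> nat" where
  "leaves Leaf = 1"
| "leaves (a \<stileturn> b) = leaves a + leaves b"
| "leaves (a \<turnstile> b) = leaves a + leaves b"

text \<open>\<open>graft s i t\<close> replaces the \<open>i\<close>-th leaf of \<open>s\<close> by \<open>t\<close>; it is only used for
  \<open>1 \<le> i \<le> leaves s\<close>.\<close>

fun graft :: "dtree \<Rightarrow> nat \<Rightarrow> dtree \<Rightarrow> dtree" where
  "graft Leaf i t = t"
| "graft (a \<stileturn> b) i t =
    (if i \<le> leaves a then graft a i t \<stileturn> b else a \<stileturn> graft b (i - leaves a) t)"
| "graft (a \<turnstile> b) i t =
    (if i \<le> leaves a then graft a i t \<turnstile> b else a \<turnstile> graft b (i - leaves a) t)"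

type_synonym free_dtree = "dtree \<Rightarrow>\<^sub>0 rat"

definition free_space :: "nat \<Rightarrow> free_dtree set" where
  "free_space n = {f. \<forall>t\<in>Poly_Mapping.keys f. leaves t = n}"

definition free_mono :: "dtree \<Rightarrow> free_dtree" where
  "free_mono t = Poly_Mapping.single t 1"

definition free_scale :: "rat \<Rightarrow> free_dtree \<Rightarrow> free_dtree" where
  "free_scale c f = Poly_Mapping.map ((*) c) f"

text \<open>Bilinear extension of grafting to the whole direct sum; trees with fewer than \<open>i\<close> leaves
  contribute 0.\<close>

definition free_comp :: "free_dtree \<Rightarrow> nat \<Rightarrow> free_dtree \<Rightarrow> free_dtree" where
  "free_comp f i g =
    (\<Sum>s\<in>{s \<in> Poly_Mapping.keys f. 1 \<le> i \<and> i \<le> leaves s}. \<Sum>t\<in>Poly_Mapping.keys g.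
      Poly_Mapping.single (graft s i t) (Poly_Mapping.lookup f s * Poly_Mapping.lookup g t))"


section \<open>The diassociative operad\<close>

definition dias_relations :: "free_dtree set" where
  "dias_relations =
    {free_mono (Leaf \<stileturn> (Leaf \<turnstile> Leaf)) - free_mono (Leaf \<stileturn> (Leaf \<stileturn> Leaf)),
     free_mono (Leaf \<stileturn> (Leaf \<stileturn> Leaf)) - free_mono ((Leaf \<stileturn> Leaf) \<stileturn> Leaf),
     free_mono (Leaf \<turnstile> (Leaf \<stileturn> Leaf)) - free_mono ((Leaf \<turnstile> Leaf) \<stileturn> Leaf),
     free_mono (Leaf \<turnstile> (Leaf \<turnstile> Leaf)) - free_mono ((Leaf \<turnstile> Leaf) \<turnstile> Leaf),
     free_mono ((Leaf \<turnstile> Leaf) \<turnstile> Leaf) - free_mono ((Leaf \<stileturn> Leaf) \<turnstile> Leaf)}"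

text \<open>The operadic ideal generated by the relations, or rather the direct sum of its components
  over all arities.\<close>

inductive_set dias_ideal :: "free_dtree set" where
  rel: "r \<in> dias_relations \<Longrightarrow> r \<in> dias_ideal"
| zero: "0 \<in> dias_ideal"
| add: "\<lbrakk>f \<in> dias_ideal; g \<in> dias_ideal\<rbrakk> \<Longrightarrow> f + g \<in> dias_ideal"
| scale: "f \<in> dias_ideal \<Longrightarrow> free_scale c f \<in> dias_ideal"
| comp_left: "\<lbrakk>f \<in> dias_ideal; f \<in> free_space m; g \<in> free_space n; 1 \<le> i; i \<le> m\<rbrakk>
    \<Longrightarrow> free_comp f i g \<in> dias_ideal"
| comp_right: "\<lbrakk>g \<in> dias_ideal; f \<in> free_space m; g \<in> free_space n; 1 \<le> i; i \<le> m\<rbrakk>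
    \<Longrightarrow> free_comp f i g \<in> dias_ideal"

lemma lookup_free_scale [simp]:
  "Poly_Mapping.lookup (free_scale c f) t = c * Poly_Mapping.lookup f t"
  unfolding free_scale_def by transfer (simp add: when_def)

lemma free_scale_minus_one: "free_scale (- 1) f = - f"
  by (rule poly_mapping_eqI) simp

lemma dias_ideal_uminus: "f \<in> dias_ideal \<Longrightarrow> - f \<in> dias_ideal"
  using dias_ideal.scale[of f "- 1"] by (simp add: free_scale_minus_one)

lemma dias_ideal_diff: "\<lbrakk>f \<in> dias_ideal; g \<in> dias_ideal\<rbrakk> \<Longrightarrow> f - g \<in> dias_ideal"
  using dias_ideal.add[OF _ dias_ideal_uminus, of f g] by simp

lemma dias_ideal_sum: "(\<And>x. x \<in> A \<Longrightarrow> h x \<in> dias_ideal) \<Longrightarrow> sum h A \<in> dias_ideal"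
  by (induction A rule: infinite_finite_induct) (auto intro: dias_ideal.zero dias_ideal.add)

lemma free_comp_superset:
  assumes "finite A" "finite B" "Poly_Mapping.keys f \<subseteq> A" "Poly_Mapping.keys g \<subseteq> B"
  shows "free_comp f i g = (\<Sum>s\<in>A. \<Sum>t\<in>B. if 1 \<le> i \<and> i \<le> leaves s
    then Poly_Mapping.single (graft s i t) (Poly_Mapping.lookup f s * Poly_Mapping.lookup g t)
    else 0)"
proof -
  let ?h = "\<lambda>s t. Poly_Mapping.single (graft s i t)
    (Poly_Mapping.lookup f s * Poly_Mapping.lookup g t)"
  have inner: "(\<Sum>t\<in>Poly_Mapping.keys g. ?h s t) = (\<Sum>t\<in>B. ?h s t)" for s
    by (rule sum.mono_neutral_left) (use assms in \<open>auto simp: in_keys_iff\<close>)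
  have "free_comp f i g = (\<Sum>s\<in>{s \<in> Poly_Mapping.keys f. 1 \<le> i \<and> i \<le> leaves s}. \<Sum>t\<in>B. ?h s t)"
    unfolding free_comp_def by (simp add: inner)
  also have "\<dots> = (\<Sum>s\<in>{s \<in> A. 1 \<le> i \<and> i \<le> leaves s}. \<Sum>t\<in>B. ?h s t)"
    by (rule sum.mono_neutral_left) (use assms in \<open>auto simp: in_keys_iff\<close>)
  also have "\<dots> = (\<Sum>s\<in>A. if 1 \<le> i \<and> i \<le> leaves s then \<Sum>t\<in>B. ?h s t else 0)"
    using assms(1) by (rule sum.inter_filter)
  also have "\<dots> = (\<Sum>s\<in>A. \<Sum>t\<in>B. if 1 \<le> i \<and> i \<le> leaves s then ?h s t else 0)"
    by (intro sum.cong) auto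
  finally show ?thesis .
qed

lemma free_comp_add_left: "free_comp (f + f') i g = free_comp f i g + free_comp f' i g"
proof -
  let ?A = "Poly_Mapping.keys f \<union> Poly_Mapping.keys f'"
  have *: "free_comp k i g = (\<Sum>s\<in>?A. \<Sum>t\<in>Poly_Mapping.keys g. if 1 \<le> i \<and> i \<le> leaves s
    then Poly_Mapping.single (graft s i t) (Poly_Mapping.lookup k s * Poly_Mapping.lookup g t)
    else 0)" if "Poly_Mapping.keys k \<subseteq> ?A" for k
    by (rule free_comp_superset) (use that in auto)
  have "Poly_Mapping.keys (f + f') \<subseteq> ?A"
    by (rule Poly_Mapping.keys_add)
  from *[OF this] show ?thesis
    by (simp add: * flip: sum.distrib)
       (intro sum.cong refl, simp add: lookup_add distrib_right single_add)
qed

lemma free_comp_add_right: "free_comp f i (g + g') = free_comp f i g + free_comp f i g'"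
proof -
  let ?B = "Poly_Mapping.keys g \<union> Poly_Mapping.keys g'"
  have *: "free_comp f i k = (\<Sum>s\<in>Poly_Mapping.keys f. \<Sum>t\<in>?B. if 1 \<le> i \<and> i \<le> leaves s
    then Poly_Mapping.single (graft s i t) (Poly_Mapping.lookup f s * Poly_Mapping.lookup k t)
    else 0)" if "Poly_Mapping.keys k \<subseteq> ?B" for k
    by (rule free_comp_superset) (use that in auto)
  have "Poly_Mapping.keys (g + g') \<subseteq> ?B"
    by (rule Poly_Mapping.keys_add)
  from *[OF this] show ?thesis
    by (simp add: * flip: sum.distrib)
       (intro sum.cong refl, simp add: lookup_add distrib_left single_add)
qed

lemma free_scale_add: "free_scale c (f + g) = free_scale c f + free_scale c g"
  by (rule poly_mapping_eqI) (simp add: lookup_add distrib_left)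

lemma free_scale_0: "free_scale c 0 = 0"
  by (rule poly_mapping_eqI) simp

lemma free_scale_sum: "free_scale c (sum h A) = (\<Sum>x\<in>A. free_scale c (h x))"
  by (induction A rule: infinite_finite_induct) (simp_all add: free_scale_add free_scale_0)

lemma free_scale_single:
  "free_scale c (Poly_Mapping.single t a) = Poly_Mapping.single t (c * a)"
  unfolding free_scale_def by simp

lemma keys_free_scale: "Poly_Mapping.keys (free_scale c f) \<subseteq> Poly_Mapping.keys f"
  by (auto simp: in_keys_iff)

lemma free_comp_scale_left: "free_comp (free_scale c f) i g = free_scale c (free_comp f i g)"
  unfolding free_comp_superset[where f = "free_scale c f", OF finite_keys finite_keys keys_free_scale subset_refl]
    free_comp_superset[of "Poly_Mapping.keys f" "Poly_Mapping.keys g" f g,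
      OF finite_keys finite_keys subset_refl subset_refl] free_scale_sum
  by (intro sum.cong refl) (simp add: free_scale_single free_scale_0 mult.assoc)

lemma free_comp_scale_right: "free_comp f i (free_scale c g) = free_scale c (free_comp f i g)"
  unfolding free_comp_superset[where g = "free_scale c g", OF finite_keys finite_keys subset_refl keys_free_scale]
    free_comp_superset[of "Poly_Mapping.keys f" "Poly_Mapping.keys g" f g,
      OF finite_keys finite_keys subset_refl subset_refl] free_scale_sum
  by (intro sum.cong refl) (simp add: free_scale_single free_scale_0 mult.left_commute)

lemma free_comp_0_left [simp]: "free_comp 0 i g = 0"
  by (simp add: free_comp_def)

lemma free_comp_0_right [simp]: "free_comp f i 0 = 0"
  by (simp add: free_comp_def)

lemma free_comp_diff_left: "free_comp (f - f') i g = free_comp f i g - free_comp f' i g"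
  using free_comp_add_left[of "f - f'" f' i g] by simp

lemma free_comp_diff_right: "free_comp f i (g - g') = free_comp f i g - free_comp f i g'"
  using free_comp_add_right[of f i "g - g'" g'] by simp

lemma free_comp_sum_left: "free_comp (sum h A) i g = (\<Sum>x\<in>A. free_comp (h x) i g)"
  by (induction A rule: infinite_finite_induct) (simp_all add: free_comp_add_left)

lemma free_comp_sum_right: "free_comp f i (sum h A) = (\<Sum>x\<in>A. free_comp f i (h x))"
  by (induction A rule: infinite_finite_induct) (simp_all add: free_comp_add_right)

lemma free_dtree_decompose:
  "f = (\<Sum>t\<in>Poly_Mapping.keys f. Poly_Mapping.single t (Poly_Mapping.lookup f t))"
  by (rule poly_mapping_eqI)
     (simp add: lookup_sum lookup_single when_def sum.delta' in_keys_iff)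

lemma single_free_space: "Poly_Mapping.single t a \<in> free_space (leaves t)"
  by (simp add: free_space_def)

lemma free_comp_out_of_range:
  assumes "f \<in> free_space m" "\<not> (1 \<le> i \<and> i \<le> m)"
  shows "free_comp f i g = 0"
proof -
  have *: "{s \<in> Poly_Mapping.keys f. 1 \<le> i \<and> i \<le> leaves s} = {}"
    using assms by (auto simp: free_space_def)
  show ?thesis unfolding free_comp_def * by simp
qed

lemma leaves_graft: "\<lbrakk>1 \<le> i; i \<le> leaves s\<rbrakk> \<Longrightarrow> leaves (graft s i t) = leaves s + leaves t - 1"
proof (induction s arbitrary: i)
  have pos: "1 \<le> leaves u" for u by (induction u) auto
  {
    case Leaf then show ?case by simp
  next
    case (LeftProd a b)
    then show ?case using pos[of a] pos[of b] pos[of t]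
      LeftProd.IH(1)[of i] LeftProd.IH(2)[of "i - leaves a"] by auto
  next
    case (RightProd a b)
    then show ?case using pos[of a] pos[of b] pos[of t]
      RightProd.IH(1)[of i] RightProd.IH(2)[of "i - leaves a"] by auto
  }
qed

lemma free_comp_free_space:
  assumes "f \<in> free_space m" "g \<in> free_space n"
  shows "free_comp f i g \<in> free_space (m + n - 1)"
proof -
  have sum_in: "sum h A \<in> free_space k" if "\<And>x. x \<in> A \<Longrightarrow> h x \<in> free_space k"
    for h :: "dtree \<Rightarrow> free_dtree" and A k
    using that
  proof (induction A rule: infinite_finite_induct)
    case (insert x F)
    then show ?case
      using Poly_Mapping.keys_add[of "h x" "sum h F"] by (auto simp: free_space_def)
  qed (simp_all add: free_space_def)
  show ?thesis
    unfolding free_comp_def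
    by (intro sum_in) (use assms in \<open>auto simp: free_space_def leaves_graft\<close>)
qed

text \<open>All relations are homogeneous, so the ideal is closed under composition with arbitrary,
  also inhomogeneous, elements.\<close>

lemma dias_ideal_comp_homogeneous_left:
  assumes "f \<in> dias_ideal" "f \<in> free_space m"
  shows "free_comp f i g \<in> dias_ideal"
proof (cases "1 \<le> i \<and> i \<le> m")
  case True
  have "free_comp f i (\<Sum>t\<in>Poly_Mapping.keys g. Poly_Mapping.single t (Poly_Mapping.lookup g t))
      \<in> dias_ideal"
    unfolding free_comp_sum_right
    using True by (intro dias_ideal_sum dias_ideal.comp_left[OF assms single_free_space]) auto
  then show ?thesis by (simp flip: free_dtree_decompose)
next
  case False
  then show ?thesis by (simp add: free_comp_out_of_range[OF assms(2)] dias_ideal.zero)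
qed

lemma dias_ideal_comp_homogeneous_right:
  assumes "g \<in> dias_ideal" "g \<in> free_space n"
  shows "free_comp f i g \<in> dias_ideal"
proof -
  have "free_comp (Poly_Mapping.single t a) i g \<in> dias_ideal" for t a
  proof (cases "1 \<le> i \<and> i \<le> leaves t")
    case True
    then show ?thesis
      using dias_ideal.comp_right[OF assms(1) single_free_space assms(2)] by blast
  next
    case False
    then show ?thesis
      by (simp add: free_comp_out_of_range[OF single_free_space] dias_ideal.zero)
  qed
  then have "free_comp (\<Sum>t\<in>Poly_Mapping.keys f. Poly_Mapping.single t (Poly_Mapping.lookup f t)) i g
      \<in> dias_ideal"
    unfolding free_comp_sum_left by (intro dias_ideal_sum)
  then show ?thesis by (simp flip: free_dtree_decompose)
qed

lemma dias_relations_homogeneous: "r \<in> dias_relations \<Longrightarrow> r \<in> free_space 3"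
  unfolding dias_relations_def free_mono_def free_space_def
  by (auto simp: in_keys_iff lookup_minus lookup_single when_def split: if_splits)

lemma dias_ideal_comp_left: "f \<in> dias_ideal \<Longrightarrow> free_comp f i g \<in> dias_ideal"
proof (induction f rule: dias_ideal.induct)
  case (rel r)
  then show ?case
    by (intro dias_ideal_comp_homogeneous_left[OF dias_ideal.rel dias_relations_homogeneous])
next
  case (comp_left f m h n j)
  then show ?case
    by (intro dias_ideal_comp_homogeneous_left[OF dias_ideal.comp_left free_comp_free_space])
next
  case (comp_right h f m n j)
  then show ?case
    by (intro dias_ideal_comp_homogeneous_left[OF dias_ideal.comp_right free_comp_free_space])
qed (simp_all add: dias_ideal.zero dias_ideal.add dias_ideal.scale free_comp_add_left
      free_comp_scale_left)

lemma dias_ideal_comp_right: "g \<in> dias_ideal \<Longrightarrow> free_comp f i g \<in> dias_ideal"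
proof (induction g rule: dias_ideal.induct)
  case (rel r)
  then show ?case
    by (intro dias_ideal_comp_homogeneous_right[OF dias_ideal.rel dias_relations_homogeneous])
next
  case (comp_left f m h n j)
  then show ?case
    by (intro dias_ideal_comp_homogeneous_right[OF dias_ideal.comp_left free_comp_free_space])
next
  case (comp_right h f m n j)
  then show ?case
    by (intro dias_ideal_comp_homogeneous_right[OF dias_ideal.comp_right free_comp_free_space])
qed (simp_all add: dias_ideal.zero dias_ideal.add dias_ideal.scale free_comp_add_right
      free_comp_scale_right)

definition dias_eq :: "free_dtree \<Rightarrow> free_dtree \<Rightarrow> bool" where
  "dias_eq f g \<longleftrightarrow> f - g \<in> dias_ideal"

text \<open>The direct sum of all the spaces \<open>Dias n\<close>.\<close>

quotient_type dias = free_dtree / dias_eq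
proof (rule equivpI)
  show "reflp dias_eq"
    by (rule reflpI) (simp add: dias_eq_def dias_ideal.zero)
  show "symp dias_eq"
    by (rule sympI) (use dias_ideal_uminus in \<open>force simp: dias_eq_def\<close>)
  show "transp dias_eq"
    by (rule transpI) (use dias_ideal.add in \<open>force simp: dias_eq_def\<close>)
qed

instantiation dias :: ab_group_add
begin

lift_definition zero_dias :: dias is 0 .

lift_definition plus_dias :: "dias \<Rightarrow> dias \<Rightarrow> dias" is "(+)"
  unfolding dias_eq_def add_diff_add by (rule dias_ideal.add)

lift_definition uminus_dias :: "dias \<Rightarrow> dias" is uminus
  unfolding dias_eq_def minus_diff_minus by (rule dias_ideal_uminus)

lift_definition minus_dias :: "dias \<Rightarrow> dias \<Rightarrow> dias" is "(-)"
proof -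
  fix f f' g g' assume "dias_eq f f'" "dias_eq g g'"
  then have "(f - f') - (g - g') \<in> dias_ideal"
    unfolding dias_eq_def by (rule dias_ideal_diff)
  then show "dias_eq (f - g) (f' - g')"
    unfolding dias_eq_def by (simp add: algebra_simps)
qed

instance
  by standard (transfer; simp add: dias_eq_def dias_ideal.zero algebra_simps)+

end

lift_definition dias_scale :: "rat \<Rightarrow> dias \<Rightarrow> dias" is free_scale
proof -
  fix c f g assume "dias_eq f g"
  moreover have "free_scale c f - free_scale c g = free_scale c (f - g)"
    by (rule poly_mapping_eqI) (simp add: lookup_minus right_diff_distrib)
  ultimately show "dias_eq (free_scale c f) (free_scale c g)"
    unfolding dias_eq_def by (simp add: dias_ideal.scale)
qed

lift_definition dias_comp :: "dias \<Rightarrow> nat \<Rightarrow> dias \<Rightarrow> dias" is free_comp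
proof -
  fix f f' i g g' assume "dias_eq f f'" "dias_eq g g'"
  then have "free_comp (f - f') i g + free_comp f' i (g - g') \<in> dias_ideal"
    unfolding dias_eq_def by (intro dias_ideal.add dias_ideal_comp_left dias_ideal_comp_right)
  then show "dias_eq (free_comp f i g) (free_comp f' i g')"
    unfolding dias_eq_def by (simp add: free_comp_diff_left free_comp_diff_right)
qed

lift_definition dias_mono :: "dtree \<Rightarrow> dias" is free_mono .

definition Dias :: "nat \<Rightarrow> dias set" where
  "Dias n = abs_dias ` free_space n"

abbreviation dias_unit :: dias where
  "dias_unit \<equiv> dias_mono Leaf"

abbreviation dias_left :: dias where
  "dias_left \<equiv> dias_mono (Leaf \<stileturn> Leaf)"

abbreviation dias_right :: dias where
  "dias_right \<equiv> dias_mono (Leaf \<turnstile> Leaf)"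

end

theory Submission
  imports Defs
begin

text \<open>
  A monomial of the free operad on \<open>\<stileturn>\<close> and \<open>\<turnstile>\<close> has a \<^emph>\<open>middle\<close> variable: descend from the root, each
  operation pointing to one of its two arguments. Modulo the diassociative relations a monomial is
  determined by its arity \<open>n\<close> and the position \<open>m\<close> of its middle variable, so \<open>Dias n\<close> is spanned by
  the \<open>n\<close> elements \<open>e\<^sub>m = x\<^sub>1 \<turnstile> \<dots> \<turnstile> x\<^sub>m \<stileturn> \<dots> \<stileturn> x\<^sub>n\<close>, and composing two of them moves the middle in
  an evident way (\<open>dias_comp_basis\<close>).

  Every \<open>e\<^sub>m\<close> of arity \<open>n \<ge> 2\<close> is \<open>x \<stileturn> y\<close> or \<open>x \<turnstile> y\<close> with some basis element of arity \<open>n - 1\<close>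
  substituted for the second variable. The axiom for \<open>f \<circ>\<^sub>2 g\<close> therefore computes \<open>\<tau>\<close> from \<open>\<tau>\<^sub>2\<close>
  with no recursion, and the outcome is \<open>\<tau> e\<^sub>m = e\<^bsub>m-1\<^esub> - e\<^sub>n\<close> with \<open>e\<^sub>0 = 0\<close>. This is uniqueness
  (\<open>anticyclic_Dias_unique\<close>).

  For existence, this formula is used as a definition. It makes sense on the quotient because a
  linear map on the free operad that only depends on arity and middle of monomials kills the
  operadic ideal (\<open>linext_ideal\<close>). The formula has order \<open>n + 1\<close> for a conceptual reason: in the
  permutation representation of the cyclic group with basis \<open>v\<^sub>0, \<dots>, v\<^sub>n\<close>, the differences
  \<open>e\<^sub>m = v\<^sub>m - v\<^sub>0\<close> transform in this way under \<open>v\<^sub>m \<mapsto> v\<^bsub>m-1\<^esub>\<close>, indices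
  being read modulo \<open>n + 1\<close>. The remaining axioms are multilinear, so that checking them amounts to
  comparing indices on basis elements.
\<close>

section \<open>Compositions of monomials\<close>

lemma leaves_pos: "1 \<le> leaves t"
  by (induction t) auto

fun middle :: "dtree \<Rightarrow> nat" where
  "middle Leaf = 1"
| "middle (a \<stileturn> b) = middle a"
| "middle (a \<turnstile> b) = leaves a + middle b"

lemma middle_pos: "1 \<le> middle t"
  by (induction t) auto

lemma middle_le_leaves: "middle t \<le> leaves t"
  by (induction t) auto

lemma middle_graft:
  "\<lbrakk>1 \<le> i; i \<le> leaves s\<rbrakk> \<Longrightarrow> middle (graft s i t) =
    (if middle s < i then middle s
     else if middle s = i then middle s + middle t - 1
     else middle s + leaves t - 1)"
proof (induction s arbitrary: i)
  case Leaf
  then show ?case by simp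
next
  case (LeftProd a b)
  then show ?case
    using middle_le_leaves[of a] by auto
next
  case (RightProd a b)
  show ?case
    using RightProd.prems RightProd.IH(2)[of "i - leaves a"] middle_pos[of b] middle_pos[of t]
      leaves_pos[of a] leaves_pos[of t]
    by (auto simp: leaves_graft)
qed

lemma free_comp_mono:
  assumes "1 \<le> i" "i \<le> leaves s"
  shows "free_comp (free_mono s) i (free_mono t) = free_mono (graft s i t)"
proof -
  have "{u \<in> Poly_Mapping.keys (free_mono s). 1 \<le> i \<and> i \<le> leaves u} = {s}"
    using assms by (auto simp: free_mono_def)
  then show ?thesis
    by (simp add: free_comp_def) (simp add: free_mono_def)
qed

lemma dias_comp_mono:
  "\<lbrakk>1 \<le> i; i \<le> leaves s\<rbrakk> \<Longrightarrow>
    dias_comp (dias_mono s) i (dias_mono t) = dias_mono (graft s i t)"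
  by (simp add: dias_mono.abs_eq dias_comp.abs_eq free_comp_mono)


section \<open>The vector spaces of the diassociative operad\<close>

global_interpretation dias: vector_space dias_scale
proof
  fix a b :: rat and x y :: dias
  show "dias_scale a (x + y) = dias_scale a x + dias_scale a y"
    by transfer (simp add: dias_eq_def dias_ideal.zero free_scale_add)
  show "dias_scale (a + b) x = dias_scale a x + dias_scale b x"
  proof transfer
    fix a b :: rat and f :: free_dtree
    have "free_scale (a + b) f = free_scale a f + free_scale b f"
      by (rule poly_mapping_eqI) (simp add: lookup_add distrib_right)
    then show "dias_eq (free_scale (a + b) f) (free_scale a f + free_scale b f)"
      by (simp add: dias_eq_def dias_ideal.zero)
  qed
  show "dias_scale a (dias_scale b x) = dias_scale (a * b) x"
  proof transfer
    fix a b :: rat and f :: free_dtree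
    have "free_scale a (free_scale b f) = free_scale (a * b) f"
      by (rule poly_mapping_eqI) simp
    then show "dias_eq (free_scale a (free_scale b f)) (free_scale (a * b) f)"
      by (simp add: dias_eq_def dias_ideal.zero)
  qed
  show "dias_scale 1 x = x"
  proof transfer
    fix f :: free_dtree
    have "free_scale 1 f = f"
      by (rule poly_mapping_eqI) simp
    then show "dias_eq (free_scale 1 f) f"
      by (simp add: dias_eq_def dias_ideal.zero)
  qed
qed

lemma dias_comp_add_left: "dias_comp (x + x') i y = dias_comp x i y + dias_comp x' i y"
  by transfer (simp add: dias_eq_def dias_ideal.zero free_comp_add_left)

lemma dias_comp_add_right: "dias_comp x i (y + y') = dias_comp x i y + dias_comp x i y'"
  by transfer (simp add: dias_eq_def dias_ideal.zero free_comp_add_right)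

lemma dias_comp_scale_left: "dias_comp (dias_scale c x) i y = dias_scale c (dias_comp x i y)"
  by transfer (simp add: dias_eq_def dias_ideal.zero free_comp_scale_left)

lemma dias_comp_scale_right: "dias_comp x i (dias_scale c y) = dias_scale c (dias_comp x i y)"
  by transfer (simp add: dias_eq_def dias_ideal.zero free_comp_scale_right)

lemma dias_comp_0_left [simp]: "dias_comp 0 i y = 0"
  by transfer (simp add: dias_eq_def dias_ideal.zero)

lemma dias_comp_0_right [simp]: "dias_comp x i 0 = 0"
  by transfer (simp add: dias_eq_def dias_ideal.zero)

lemma dias_comp_diff_left: "dias_comp (x - x') i y = dias_comp x i y - dias_comp x' i y"
  using dias_comp_add_left[of "x - x'" x' i y] by simp

lemma dias_comp_diff_right: "dias_comp x i (y - y') = dias_comp x i y - dias_comp x i y'"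
  using dias_comp_add_right[of x i "y - y'" y'] by simp

lemma dias_comp_minus_left: "dias_comp (- x) i y = - dias_comp x i y"
  using dias_comp_diff_left[of 0 x i y] by simp

lemma dias_comp_minus_right: "dias_comp x i (- y) = - dias_comp x i y"
  using dias_comp_diff_right[of x i 0 y] by simp

lemma dias_mono_in_Dias: "dias_mono t \<in> Dias (leaves t)"
  unfolding Dias_def dias_mono.abs_eq free_mono_def using single_free_space by blast

lemma subspace_Dias: "dias.subspace (Dias n)"
proof (rule dias.subspaceI)
  have "0 \<in> free_space n"
    by (simp add: free_space_def)
  then show "0 \<in> Dias n"
    by (auto simp: Dias_def zero_dias.abs_eq)
  show "x + y \<in> Dias n" if xy: "x \<in> Dias n" "y \<in> Dias n" for x y
  proof -
    obtain f g where fg: "x = abs_dias f" "f \<in> free_space n" "y = abs_dias g" "g \<in> free_space n"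
      using xy by (auto simp: Dias_def)
    then have "f + g \<in> free_space n"
      using Poly_Mapping.keys_add[of f g] by (auto simp: free_space_def)
    then show ?thesis
      by (auto simp: Dias_def fg plus_dias.abs_eq)
  qed
  show "dias_scale c x \<in> Dias n" if x: "x \<in> Dias n" for c x
  proof -
    obtain f where f: "x = abs_dias f" "f \<in> free_space n"
      using x by (auto simp: Dias_def)
    then have "free_scale c f \<in> free_space n"
      using keys_free_scale[of c f] by (auto simp: free_space_def)
    then show ?thesis
      by (auto simp: Dias_def f dias_scale.abs_eq)
  qed
qed

lemma dias_comp_in: "\<lbrakk>x \<in> Dias m; y \<in> Dias n\<rbrakk> \<Longrightarrow> dias_comp x i y \<in> Dias (m + n - 1)"
  using free_comp_free_space by (force simp: Dias_def dias_comp.abs_eq)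

definition linext :: "(dtree \<Rightarrow> dias) \<Rightarrow> free_dtree \<Rightarrow> dias" where
  "linext h f = (\<Sum>t\<in>Poly_Mapping.keys f. dias_scale (Poly_Mapping.lookup f t) (h t))"

lemma linext_superset:
  assumes "finite A" "Poly_Mapping.keys f \<subseteq> A"
  shows "linext h f = (\<Sum>t\<in>A. dias_scale (Poly_Mapping.lookup f t) (h t))"
  unfolding linext_def
  by (rule sum.mono_neutral_left) (use assms in \<open>auto simp: in_keys_iff\<close>)

lemma linext_add: "linext h (f + g) = linext h f + linext h g"
proof -
  let ?A = "Poly_Mapping.keys f \<union> Poly_Mapping.keys g"
  have *: "linext h k = (\<Sum>t\<in>?A. dias_scale (Poly_Mapping.lookup k t) (h t))"
    if "Poly_Mapping.keys k \<subseteq> ?A" for k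
    by (rule linext_superset) (use that in auto)
  have "Poly_Mapping.keys (f + g) \<subseteq> ?A"
    by (rule Poly_Mapping.keys_add)
  from *[OF this] show ?thesis
    by (simp add: * lookup_add dias.scale_left_distrib sum.distrib)
qed

lemma linext_0 [simp]: "linext h 0 = 0"
  by (simp add: linext_def)

lemma linext_diff: "linext h (f - g) = linext h f - linext h g"
  using linext_add[of h "f - g" g] by simp

lemma linext_scale: "linext h (free_scale c f) = dias_scale c (linext h f)"
  unfolding linext_superset[OF finite_keys keys_free_scale]
  by (simp add: linext_def dias.scale_sum_right)

lemma linext_sum: "linext h (sum k A) = (\<Sum>x\<in>A. linext h (k x))"
  by (induction A rule: infinite_finite_induct) (simp_all add: linext_add)

lemma linext_single: "linext h (Poly_Mapping.single t c) = dias_scale c (h t)"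
  by (simp add: linext_def)

lemma linext_mono: "linext h (free_mono t) = h t"
  by (simp add: free_mono_def linext_single)

lemma abs_dias_eq_linext: "abs_dias f = linext dias_mono f"
proof -
  have abs_sum: "abs_dias (sum k A) = (\<Sum>x\<in>A. abs_dias (k x))"
    for k :: "dtree \<Rightarrow> free_dtree" and A
    by (induction A rule: infinite_finite_induct)
       (simp_all flip: zero_dias.abs_eq plus_dias.abs_eq)
  have "abs_dias f =
      abs_dias (\<Sum>t\<in>Poly_Mapping.keys f. Poly_Mapping.single t (Poly_Mapping.lookup f t))"
    by (simp flip: free_dtree_decompose)
  also have "\<dots> = linext dias_mono f"
    by (simp add: abs_sum linext_def dias_mono.abs_eq dias_scale.abs_eq free_mono_def
        free_scale_single)
  finally show ?thesis .
qed

lemma linext_comp: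
  "linext h (free_comp f i g) =
    linext (\<lambda>s. if 1 \<le> i \<and> i \<le> leaves s then linext (\<lambda>t. h (graft s i t)) g else 0) f"
proof -
  have "linext h (free_comp f i g) =
    (\<Sum>s\<in>{s \<in> Poly_Mapping.keys f. 1 \<le> i \<and> i \<le> leaves s}.
      dias_scale (Poly_Mapping.lookup f s) (linext (\<lambda>t. h (graft s i t)) g))"
    unfolding free_comp_def linext_sum linext_single
    by (simp add: linext_def dias.scale_sum_right)
  also have "\<dots> = (\<Sum>s\<in>Poly_Mapping.keys f. if 1 \<le> i \<and> i \<le> leaves s then
      dias_scale (Poly_Mapping.lookup f s) (linext (\<lambda>t. h (graft s i t)) g) else 0)"
    by (rule sum.inter_filter) simp
  also have "\<dots> = linext
      (\<lambda>s. if 1 \<le> i \<and> i \<le> leaves s then linext (\<lambda>t. h (graft s i t)) g else 0) f"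
    unfolding linext_def[of _ f] by (intro sum.cong) auto
  finally show ?thesis .
qed

text \<open>
  Arity and middle of a grafting depend only on arities and middles of its two arguments. Hence,
  if \<open>h\<close> factors through arity and middle, then so does \<open>s \<mapsto> h (graft s i t)\<close> for fixed \<open>t\<close>, and
  \<open>t \<mapsto> h (graft s i t)\<close> for fixed \<open>s\<close>; this is what keeps the induction over the ideal going, with
  \<open>h\<close> varying.
\<close>

lemma linext_ideal:
  assumes "f \<in> dias_ideal"
    and "\<And>s t. \<lbrakk>leaves s = leaves t; middle s = middle t\<rbrakk> \<Longrightarrow> h s = h t"
  shows "linext h f = 0"
  using assms
proof (induction arbitrary: h rule: dias_ideal.induct)
  case (rel r)
  from rel.hyps show ?case
    by (auto simp: dias_relations_def linext_diff linext_mono intro!: rel.prems)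
next
  case zero
  show ?case by simp
next
  case (add f g)
  have "linext h f = 0" "linext h g = 0"
    by (rule add.IH; fact add.prems)+
  then show ?case by (simp add: linext_add)
next
  case (scale f c)
  have "linext h f = 0"
    by (rule scale.IH; fact scale.prems)
  then show ?case by (simp add: linext_scale)
next
  case (comp_left f m g n i)
  show ?case
    unfolding linext_comp
  proof (rule comp_left.IH)
    fix s t assume st: "leaves s = leaves t" "middle s = middle t"
    then have "h (graft s i u) = h (graft t i u)" if "1 \<le> i" "i \<le> leaves s" for u
      using that by (intro comp_left.prems) (simp_all add: leaves_graft middle_graft)
    then show "(if 1 \<le> i \<and> i \<le> leaves s then linext (\<lambda>u. h (graft s i u)) g else 0) =
        (if 1 \<le> i \<and> i \<le> leaves t then linext (\<lambda>u. h (graft t i u)) g else 0)"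
      using st(1) by simp
  qed
next
  case (comp_right g f m n i)
  have "linext (\<lambda>t. h (graft s i t)) g = 0" if "1 \<le> i" "i \<le> leaves s" for s
    by (rule comp_right.IH, rule comp_right.prems)
       (use that in \<open>simp_all add: leaves_graft middle_graft\<close>)
  then have *: "(\<lambda>s. if 1 \<le> i \<and> i \<le> leaves s then linext (\<lambda>t. h (graft s i t)) g else 0) =
      (\<lambda>s. 0)"
    by auto
  show ?case
    unfolding linext_comp * by (simp add: linext_def)
qed


section \<open>Normal forms of monomials\<close>

lemma dias_mono_relations:
  "dias_mono (Leaf \<stileturn> (Leaf \<turnstile> Leaf)) = dias_mono (Leaf \<stileturn> (Leaf \<stileturn> Leaf))"
  "dias_mono (Leaf \<stileturn> (Leaf \<stileturn> Leaf)) = dias_mono ((Leaf \<stileturn> Leaf) \<stileturn> Leaf)"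
  "dias_mono (Leaf \<turnstile> (Leaf \<stileturn> Leaf)) = dias_mono ((Leaf \<turnstile> Leaf) \<stileturn> Leaf)"
  "dias_mono (Leaf \<turnstile> (Leaf \<turnstile> Leaf)) = dias_mono ((Leaf \<turnstile> Leaf) \<turnstile> Leaf)"
  "dias_mono ((Leaf \<turnstile> Leaf) \<turnstile> Leaf) = dias_mono ((Leaf \<stileturn> Leaf) \<turnstile> Leaf)"
  by (simp_all add: dias_mono.abs_eq dias.abs_eq_iff dias_eq_def dias_ideal.rel dias_relations_def)

text \<open>The variables are substituted from right to left, so that the numbers of those still to be
  substituted do not change.\<close>

lemma dias_mono_substitute:
  assumes "dias_mono s = dias_mono t" "leaves s = 3" "leaves t = 3"
  shows "dias_mono (graft (graft (graft s 3 c) 2 b) 1 a) =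
    dias_mono (graft (graft (graft t 3 c) 2 b) 1 a)"
proof -
  have "dias_mono (graft (graft (graft u 3 c) 2 b) 1 a) = dias_comp (dias_comp (dias_comp
      (dias_mono u) 3 (dias_mono c)) 2 (dias_mono b)) 1 (dias_mono a)" if "leaves u = 3" for u
    using that leaves_pos[of a] leaves_pos[of b] leaves_pos[of c]
    by (simp add: dias_comp_mono leaves_graft)
  then show ?thesis
    using assms by simp
qed

lemma dias_mono_relations_instance:
  "dias_mono (a \<stileturn> (b \<turnstile> c)) = dias_mono (a \<stileturn> (b \<stileturn> c))"
  "dias_mono (a \<stileturn> (b \<stileturn> c)) = dias_mono ((a \<stileturn> b) \<stileturn> c)"
  "dias_mono (a \<turnstile> (b \<stileturn> c)) = dias_mono ((a \<turnstile> b) \<stileturn> c)"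
  "dias_mono (a \<turnstile> (b \<turnstile> c)) = dias_mono ((a \<turnstile> b) \<turnstile> c)"
  "dias_mono ((a \<turnstile> b) \<turnstile> c) = dias_mono ((a \<stileturn> b) \<turnstile> c)"
  using dias_mono_relations[THEN dias_mono_substitute, of c b a] by simp_all

lemma dias_mono_LeftProd_cong:
  assumes "dias_mono a = dias_mono a'" "dias_mono b = dias_mono b'"
  shows "dias_mono (a \<stileturn> b) = dias_mono (a' \<stileturn> b')"
proof -
  have "dias_mono (c \<stileturn> d) = dias_comp (dias_comp dias_left 2 (dias_mono d)) 1 (dias_mono c)"
    for c d
    by (simp add: dias_comp_mono)
  from this[of a b] this[of a' b'] show ?thesis
    using assms by simp
qed

lemma dias_mono_RightProd_cong:
  assumes "dias_mono a = dias_mono a'" "dias_mono b = dias_mono b'"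
  shows "dias_mono (a \<turnstile> b) = dias_mono (a' \<turnstile> b')"
proof -
  have "dias_mono (c \<turnstile> d) = dias_comp (dias_comp dias_right 2 (dias_mono d)) 1 (dias_mono c)"
    for c d
    by (simp add: dias_comp_mono)
  from this[of a b] this[of a' b'] show ?thesis
    using assms by simp
qed

definition append_right :: "nat \<Rightarrow> dtree \<Rightarrow> dtree" where
  "append_right k t = ((\<lambda>s. s \<stileturn> Leaf) ^^ k) t"

definition append_left :: "nat \<Rightarrow> dtree \<Rightarrow> dtree" where
  "append_left k t = ((\<lambda>s. Leaf \<turnstile> s) ^^ k) t"

lemma append_right_simps [simp]:
  "append_right 0 t = t"
  "append_right (Suc k) t = append_right k t \<stileturn> Leaf"
  by (simp_all add: append_right_def)

lemma append_left_simps [simp]: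
  "append_left 0 t = t"
  "append_left (Suc k) t = Leaf \<turnstile> append_left k t"
  by (simp_all add: append_left_def)

lemma append_right_add: "append_right (j + k) t = append_right j (append_right k t)"
  by (simp add: append_right_def funpow_add)

lemma append_left_add: "append_left (j + k) t = append_left j (append_left k t)"
  by (simp add: append_left_def funpow_add)

lemma leaves_append [simp]:
  "leaves (append_right k t) = leaves t + k"
  "leaves (append_left k t) = leaves t + k"
  by (induction k) auto

lemma middle_append [simp]:
  "middle (append_right k t) = middle t"
  "middle (append_left k t) = middle t + k"
  by (induction k) auto

lemma dias_mono_append_right_cong:
  "dias_mono s = dias_mono t \<Longrightarrow> dias_mono (append_right k s) = dias_mono (append_right k t)"
  by (induction k) (auto intro: dias_mono_LeftProd_cong)

lemma dias_mono_append_left_cong: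
  "dias_mono s = dias_mono t \<Longrightarrow> dias_mono (append_left k s) = dias_mono (append_left k t)"
  by (induction k) (auto intro: dias_mono_RightProd_cong)

text \<open>The relations allow any tree on the side to which an operation does not point to be taken apart
  into single variables, so that of such a tree only the number of leaves matters.\<close>

lemma dias_mono_LeftProd_flatten:
  "dias_mono (a \<stileturn> b) = dias_mono (append_right (leaves b) a)"
proof (induction b arbitrary: a)
  case Leaf
  show ?case by simp
next
  case (LeftProd c d)
  have "dias_mono (a \<stileturn> (c \<stileturn> d)) = dias_mono (append_right (leaves d) (a \<stileturn> c))"
    by (simp only: dias_mono_relations_instance(2) LeftProd.IH(2))
  also have "\<dots> = dias_mono (append_right (leaves d) (append_right (leaves c) a))"
    by (rule dias_mono_append_right_cong[OF LeftProd.IH(1)])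
  finally show ?case
    by (simp add: add.commute flip: append_right_add)
next
  case (RightProd c d)
  have "dias_mono (a \<stileturn> (c \<turnstile> d)) = dias_mono (append_right (leaves d) (a \<stileturn> c))"
    by (simp only: dias_mono_relations_instance(1,2) RightProd.IH(2))
  also have "\<dots> = dias_mono (append_right (leaves d) (append_right (leaves c) a))"
    by (rule dias_mono_append_right_cong[OF RightProd.IH(1)])
  finally show ?case
    by (simp add: add.commute flip: append_right_add)
qed

lemma dias_mono_RightProd_flatten:
  "dias_mono (a \<turnstile> b) = dias_mono (append_left (leaves a) b)"
proof (induction a arbitrary: b)
  case Leaf
  show ?case by simp
next
  case (LeftProd c d)
  have "dias_mono ((c \<stileturn> d) \<turnstile> b) = dias_mono (append_left (leaves c) (d \<turnstile> b))"
    by (simp only: LeftProd.IH(1)[symmetric] dias_mono_relations_instance(4,5))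
  also have "\<dots> = dias_mono (append_left (leaves c) (append_left (leaves d) b))"
    by (rule dias_mono_append_left_cong[OF LeftProd.IH(2)])
  finally show ?case
    by (simp flip: append_left_add)
next
  case (RightProd c d)
  have "dias_mono ((c \<turnstile> d) \<turnstile> b) = dias_mono (append_left (leaves c) (d \<turnstile> b))"
    by (simp only: RightProd.IH(1)[symmetric] dias_mono_relations_instance(4))
  also have "\<dots> = dias_mono (append_left (leaves c) (append_left (leaves d) b))"
    by (rule dias_mono_append_left_cong[OF RightProd.IH(2)])
  finally show ?case
    by (simp flip: append_left_add)
qed

lemma dias_mono_append_commute:
  "dias_mono (append_right k (append_left j t)) = dias_mono (append_left j (append_right k t))"
proof (induction k)
  case 0
  show ?case by simp
next
  case (Suc k)
  have shift: "dias_mono (append_left j u \<stileturn> Leaf) = dias_mono (append_left j (u \<stileturn> Leaf))" for u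
  proof (induction j)
    case (Suc j)
    have "dias_mono (append_left (Suc j) u \<stileturn> Leaf) = dias_mono (Leaf \<turnstile> (append_left j u \<stileturn> Leaf))"
      by (simp add: dias_mono_relations_instance(3))
    also have "\<dots> = dias_mono (Leaf \<turnstile> append_left j (u \<stileturn> Leaf))"
      by (rule dias_mono_RightProd_cong[OF refl Suc])
    finally show ?case
      by simp
  qed simp
  have "dias_mono (append_right (Suc k) (append_left j t)) =
      dias_mono (append_left j (append_right k t) \<stileturn> Leaf)"
    by (simp add: dias_mono_LeftProd_cong[OF Suc refl])
  then show ?case
    by (simp add: shift)
qed

text \<open>The value \<open>0\<close> at \<open>m = 0\<close> lets formulas that shift the middle to the left hold at the first
  basis element, too.\<close>

definition dias_basis :: "nat \<Rightarrow> nat \<Rightarrow> dias" where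
  "dias_basis n m =
    (if m = 0 then 0 else dias_mono (append_left (m - 1) (append_right (n - m) Leaf)))"

lemma dias_basis_0 [simp]: "dias_basis n 0 = 0"
  by (simp add: dias_basis_def)

lemma dias_mono_eq_basis: "dias_mono t = dias_basis (leaves t) (middle t)"
proof -
  have "dias_mono t =
      dias_mono (append_left (middle t - 1) (append_right (leaves t - middle t) Leaf))"
  proof (induction t)
    case Leaf
    show ?case by simp
  next
    case (LeftProd a b)
    have "dias_mono (a \<stileturn> b) = dias_mono (append_right (leaves b)
        (append_left (middle a - 1) (append_right (leaves a - middle a) Leaf)))"
      unfolding dias_mono_LeftProd_flatten
      by (rule dias_mono_append_right_cong[OF LeftProd.IH(1)])
    also have "\<dots> = dias_mono (append_left (middle a - 1)
        (append_right (leaves b + (leaves a - middle a)) Leaf))"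
      by (simp add: dias_mono_append_commute append_right_add)
    finally show ?case
      using middle_le_leaves[of a] by (simp add: add.commute)
  next
    case (RightProd a b)
    have "dias_mono (a \<turnstile> b) = dias_mono (append_left (leaves a)
        (append_left (middle b - 1) (append_right (leaves b - middle b) Leaf)))"
      unfolding dias_mono_RightProd_flatten
      by (rule dias_mono_append_left_cong[OF RightProd.IH(2)])
    then show ?case
      using middle_pos[of b] by (simp flip: append_left_add)
  qed
  then show ?thesis
    using middle_pos[of t] by (simp add: dias_basis_def)
qed

lemma dias_basis_in_Dias: "m \<le> n \<Longrightarrow> dias_basis n m \<in> Dias n"
  using dias_mono_in_Dias[of "append_left (m - 1) (append_right (n - m) Leaf)"]
  by (auto simp: dias_basis_def dias.subspace_0[OF subspace_Dias])

lemma dias_generators_eq_basis: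
  "dias_unit = dias_basis 1 1" "dias_left = dias_basis 2 1" "dias_right = dias_basis 2 2"
  by (simp_all add: dias_mono_eq_basis numeral_2_eq_2)

lemma dias_comp_basis:
  assumes "a \<le> m" "1 \<le> i" "i \<le> m" "1 \<le> b" "b \<le> n"
  shows "dias_comp (dias_basis m a) i (dias_basis n b) = dias_basis (m + n - 1)
    (if a < i then a else if a = i then a + b - 1 else a + n - 1)"
proof (cases "a = 0")
  case True
  then show ?thesis using assms by simp
next
  case False
  define s where "s = append_left (a - 1) (append_right (m - a) Leaf)"
  define t where "t = append_left (b - 1) (append_right (n - b) Leaf)"
  have s: "leaves s = m" "middle s = a" and t: "leaves t = n" "middle t = b"
    using assms False by (simp_all add: s_def t_def)
  have "dias_basis m a = dias_mono s" "dias_basis n b = dias_mono t"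
    using assms False by (simp_all add: dias_mono_eq_basis s t)
  then show ?thesis
    using assms by (simp add: dias_comp_mono s)
      (simp add: dias_mono_eq_basis leaves_graft middle_graft s t)
qed

lemma Dias_induct [consumes 1, case_names basis zero add scale]:
  assumes x: "x \<in> Dias n"
    and basis: "\<And>m. \<lbrakk>1 \<le> m; m \<le> n\<rbrakk> \<Longrightarrow> Q (dias_basis n m)"
    and zero: "Q 0"
    and add: "\<And>x y. \<lbrakk>x \<in> Dias n; y \<in> Dias n; Q x; Q y\<rbrakk> \<Longrightarrow> Q (x + y)"
    and scale: "\<And>c x. \<lbrakk>x \<in> Dias n; Q x\<rbrakk> \<Longrightarrow> Q (dias_scale c x)"
  shows "Q x"
proof -
  obtain f where f: "x = abs_dias f" "f \<in> free_space n"
    using x by (auto simp: Dias_def)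
  have summand: "dias_scale c (dias_mono t) \<in> Dias n \<and> Q (dias_scale c (dias_mono t))"
    if "t \<in> Poly_Mapping.keys f" for c t
  proof -
    have "leaves t = n"
      using f(2) that by (auto simp: free_space_def)
    then have "dias_mono t \<in> Dias n" "Q (dias_mono t)"
      using dias_mono_in_Dias[of t] basis[of "middle t"] middle_pos[of t] middle_le_leaves[of t]
      by (auto simp: dias_mono_eq_basis)
    then show ?thesis
      by (auto intro: scale dias.subspace_scale[OF subspace_Dias])
  qed
  have "(\<Sum>t\<in>A. dias_scale (Poly_Mapping.lookup f t) (dias_mono t)) \<in> Dias n \<and>
      Q (\<Sum>t\<in>A. dias_scale (Poly_Mapping.lookup f t) (dias_mono t))"
    if "A \<subseteq> Poly_Mapping.keys f" for A
    using finite_subset[OF that finite_keys] that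
    by (induction A rule: finite_induct)
       (use summand in \<open>auto intro: zero add dias.subspace_0[OF subspace_Dias]
          dias.subspace_add[OF subspace_Dias]\<close>)
  then show ?thesis
    unfolding f(1) abs_dias_eq_linext linext_def by blast
qed

lemmas dias_multilinear = dias_comp_add_left dias_comp_add_right dias_comp_scale_left
  dias_comp_scale_right

lemma dias_comp_unit_left: "g \<in> Dias n \<Longrightarrow> dias_comp dias_unit 1 g = g"
  by (induction g rule: Dias_induct)
     (simp_all add: dias_generators_eq_basis dias_comp_basis dias_multilinear del: One_nat_def)

lemma dias_comp_unit_right: "\<lbrakk>f \<in> Dias m; 1 \<le> i; i \<le> m\<rbrakk> \<Longrightarrow> dias_comp f i dias_unit = f"
  by (induction f rule: Dias_induct)
     (simp_all add: dias_generators_eq_basis dias_comp_basis dias_multilinear del: One_nat_def)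

lemma dias_comp_sequential:
  assumes "f \<in> Dias l" "g \<in> Dias m" "h \<in> Dias n" and i: "1 \<le> i" "i \<le> l" and j: "1 \<le> j" "j \<le> m"
  shows "dias_comp (dias_comp f i g) (i - 1 + j) h = dias_comp f i (dias_comp g j h)"
  using assms(1)
proof (induction f rule: Dias_induct)
  case (basis a)
  note a = basis
  from assms(2) show ?case
  proof (induction g rule: Dias_induct)
    case (basis b)
    note b = basis
    from assms(3) show ?case
    proof (induction h rule: Dias_induct)
      case (basis c)
      consider "a < i" | "a = i" "b < j" | "a = i" "b = j" | "a = i" "j < b" | "i < a"
        by linarith
      then show ?case
        by cases (use a b basis i j in \<open>auto simp: dias_comp_basis add.assoc\<close>)
    qed (simp_all add: dias_multilinear)
  qed (simp_all add: dias_multilinear)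
qed (simp_all add: dias_multilinear)

lemma dias_comp_parallel:
  assumes "f \<in> Dias l" "g \<in> Dias m" "h \<in> Dias n" and ik: "1 \<le> i" "i < k" "k \<le> l"
    and mn: "1 \<le> m" "1 \<le> n"
  shows "dias_comp (dias_comp f i g) (k - 1 + m) h = dias_comp (dias_comp f k h) i g"
  using assms(1)
proof (induction f rule: Dias_induct)
  case (basis a)
  note a = basis
  from assms(2) show ?case
  proof (induction g rule: Dias_induct)
    case (basis b)
    note b = basis
    from assms(3) show ?case
    proof (induction h rule: Dias_induct)
      case (basis c)
      show ?case using a b basis ik mn by (auto simp: dias_comp_basis algebra_simps)
    qed (simp_all add: dias_multilinear)
  qed (simp_all add: dias_multilinear)
qed (simp_all add: dias_multilinear)

lemma ns_operad_Dias: "ns_operad dias_scale Dias dias_unit dias_comp"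
proof
  show "dias_unit \<in> Dias 1"
    using dias_mono_in_Dias[of Leaf] by simp
qed (rule subspace_Dias dias_comp_in dias_comp_add_left dias_comp_add_right
    dias_comp_scale_left dias_comp_scale_right dias_comp_unit_left dias_comp_unit_right
    dias_comp_sequential dias_comp_parallel; assumption)+


section \<open>The cyclic rotation\<close>

lift_definition dias_tau :: "dias \<Rightarrow> dias" is
  "linext (\<lambda>t. dias_basis (leaves t) (middle t - 1) - dias_basis (leaves t) (leaves t))"
  by (metis (no_types, lifting) dias_eq_def linext_diff linext_ideal right_minus_eq)

lemma dias_tau_add: "dias_tau (x + y) = dias_tau x + dias_tau y"
  by transfer (simp add: linext_add)

lemma dias_tau_scale: "dias_tau (dias_scale c x) = dias_scale c (dias_tau x)"
  by transfer (simp add: linext_scale)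

lemma dias_tau_0 [simp]: "dias_tau 0 = 0"
  by transfer simp

lemma dias_tau_diff: "dias_tau (x - y) = dias_tau x - dias_tau y"
  using dias_tau_add[of "x - y" y] by simp

lemma dias_tau_basis:
  assumes "1 \<le> m" "m \<le> n"
  shows "dias_tau (dias_basis n m) = dias_basis n (m - 1) - dias_basis n n"
proof -
  let ?t = "append_left (m - 1) (append_right (n - m) Leaf)"
  have t: "leaves ?t = n" "middle ?t = m"
    using assms by simp_all
  have "dias_tau (dias_mono ?t) = dias_basis n (m - 1) - dias_basis n n"
    unfolding dias_mono.abs_eq dias_tau.abs_eq linext_mono t ..
  then show ?thesis
    by (simp only: dias_mono_eq_basis t)
qed

lemma dias_tau_in: "x \<in> Dias n \<Longrightarrow> dias_tau x \<in> Dias n"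
  by (induction x rule: Dias_induct)
     (auto simp: dias_tau_basis dias_tau_add dias_tau_scale intro!: dias_basis_in_Dias
        dias.subspace_diff[OF subspace_Dias] dias.subspace_add[OF subspace_Dias]
        dias.subspace_scale[OF subspace_Dias] dias.subspace_0[OF subspace_Dias])

lemma dias_tau_funpow_linear:
  "(dias_tau ^^ k) (x + y) = (dias_tau ^^ k) x + (dias_tau ^^ k) y"
  "(dias_tau ^^ k) (dias_scale c x) = dias_scale c ((dias_tau ^^ k) x)"
  "(dias_tau ^^ k) 0 = 0"
  by (induction k) (simp_all add: dias_tau_add dias_tau_scale)

text \<open>With \<open>e\<^sub>m = v\<^sub>m - v\<^sub>0\<close> as above and indices of the \<open>v\<close> read modulo \<open>n + 1\<close>, the right-hand side
  is \<open>v\<^bsub>m-k\<^esub> - v\<^bsub>-k\<^esub>\<close>.\<close>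

lemma dias_tau_funpow_basis:
  assumes "m \<le> n" "1 \<le> k" "k \<le> m"
  shows "(dias_tau ^^ k) (dias_basis n m) = dias_basis n (m - k) - dias_basis n (n + 1 - k)"
  using assms(2,3)
proof (induction k rule: dec_induct)
  case base
  then show ?case using assms(1) by (simp add: dias_tau_basis)
next
  case (step k)
  then have "dias_tau (dias_basis n (m - k)) = dias_basis n (m - Suc k) - dias_basis n n"
    "dias_tau (dias_basis n (n + 1 - k)) = dias_basis n (n + 1 - Suc k) - dias_basis n n"
    using assms(1) by (simp_all add: dias_tau_basis)
  then show ?case
    using step by (simp add: dias_tau_diff)
qed

lemma dias_tau_cyclic:
  assumes "x \<in> Dias n"
  shows "(dias_tau ^^ (n + 1)) x = x"
  using assms
proof (induction x rule: Dias_induct)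
  case (basis m)
  \<comment> \<open>The map \<open>m \<mapsto> n + 1 - m\<close> is an involution, so the rotation is split into two steps of the
    same shape, \<open>m\<close> and \<open>n + 1 - m\<close> being the two exponents.\<close>
  have reflect: "(dias_tau ^^ j) (dias_basis n j) = - dias_basis n (n + 1 - j)"
    if "1 \<le> j" "j \<le> n" for j
    using that by (simp add: dias_tau_funpow_basis)
  have "(dias_tau ^^ (n + 1)) (dias_basis n m) =
      (dias_tau ^^ (n + 1 - m)) ((dias_tau ^^ m) (dias_basis n m))"
    using basis funpow_add[of "n + 1 - m" m dias_tau] by simp
  also have "\<dots> = - (dias_tau ^^ (n + 1 - m)) (dias_basis n (n + 1 - m))"
    using basis dias_tau_funpow_linear(2)[of _ "- 1"] by (simp add: reflect dias.scale_minus_left)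
  also have "\<dots> = dias_basis n m"
    using basis reflect[of "n + 1 - m"] by simp
  finally show ?case .
qed (simp_all only: dias_tau_funpow_linear)

lemma dias_tau_comp:
  assumes "f \<in> Dias m" "g \<in> Dias n" and i: "2 \<le> i" "i \<le> m"
  shows "dias_tau (dias_comp f i g) = dias_comp (dias_tau f) (i - 1) g"
  using assms(1)
proof (induction f rule: Dias_induct)
  case (basis a)
  note a = basis
  from assms(2) show ?case
  proof (induction g rule: Dias_induct)
    case (basis b)
    show ?case
      using a basis i by (auto simp: dias_comp_basis dias_tau_basis dias_comp_diff_left)
  qed (simp_all add: dias_multilinear dias_tau_add dias_tau_scale)
qed (simp_all add: dias_multilinear dias_tau_add dias_tau_scale)

lemma dias_tau_comp_first:
  assumes "f \<in> Dias m" "g \<in> Dias n"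
  shows "dias_tau (dias_comp f 1 g) = - dias_comp (dias_tau g) n (dias_tau f)"
  using assms(1)
proof (induction f rule: Dias_induct)
  case (basis a)
  note a = basis
  from assms(2) show ?case
  proof (induction g rule: Dias_induct)
    case (basis b)
    show ?case
      using a basis
      by (cases "a = 1") (auto simp: dias_comp_basis dias_tau_basis dias_comp_diff_left
          dias_comp_diff_right dias_comp_minus_right add.commute)
  qed (simp_all add: dias_multilinear dias_tau_add dias_tau_scale)
qed (simp_all add: dias_multilinear dias_tau_add dias_tau_scale)

lemma ns_anticyclic_operad_Dias:
  assumes tau: "\<And>n x. \<lbrakk>1 \<le> n; x \<in> Dias n\<rbrakk> \<Longrightarrow> \<tau> n x = dias_tau x"
  shows "ns_anticyclic_operad dias_scale Dias dias_unit dias_comp \<tau>"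
proof -
  interpret ns_operad dias_scale Dias dias_unit dias_comp
    by (rule ns_operad_Dias)
  show ?thesis
  proof
    fix n :: nat and f :: dias assume nf: "1 \<le> n" "f \<in> Dias n"
    have "(\<tau> n ^^ k) f = (dias_tau ^^ k) f \<and> (dias_tau ^^ k) f \<in> Dias n" for k
      using nf by (induction k) (auto simp: tau dias_tau_in)
    then show "(\<tau> n ^^ (n + 1)) f = f"
      using dias_tau_cyclic[OF nf(2)] by (simp del: funpow.simps)
  next
    show "\<tau> 1 dias_unit = - dias_unit"
      by (simp only: tau[OF order_refl unit_in])
         (simp add: dias_generators_eq_basis dias_tau_basis)
  next
    fix i m n :: nat and f g :: dias
    assume "2 \<le> i" "i \<le> m" "1 \<le> n" "f \<in> Dias m" "g \<in> Dias n"
    then show "\<tau> (m + n - 1) (dias_comp f i g) = dias_comp (\<tau> m f) (i - 1) g"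
      using tau[of "m + n - 1" "dias_comp f i g"] dias_comp_in[of f m g n i]
        dias_tau_comp[of f m g n i] tau[of m f] by simp
  next
    fix m n :: nat and f g :: dias
    assume "1 \<le> m" "1 \<le> n" "f \<in> Dias m" "g \<in> Dias n"
    then show "\<tau> (m + n - 1) (dias_comp f 1 g) = - dias_comp (\<tau> n g) n (\<tau> m f)"
      using tau[of "m + n - 1" "dias_comp f 1 g"] dias_comp_in[of f m g n 1]
        dias_tau_comp_first[of f m g n] tau[of m f] tau[of n g] by simp
  qed (simp_all add: tau dias_tau_in dias_tau_add dias_tau_scale
      dias.subspace_add[OF subspace_Dias] dias.subspace_scale[OF subspace_Dias])
qed

text \<open>In arity at least 2 one has \<open>e\<^sub>1 = (x\<^sub>1 \<stileturn> x\<^sub>2) \<circ>\<^sub>2 e\<^sub>1\<close> and \<open>e\<^bsub>m+1\<^esub> = (x\<^sub>1 \<turnstile> x\<^sub>2) \<circ>\<^sub>2 e\<^sub>m\<close>, where the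
  right-hand sides use basis elements of arity one less, and \<open>\<tau> (f \<circ>\<^sub>2 g) = \<tau> f \<circ>\<^sub>1 g\<close> applies \<open>\<tau>\<close> to
  the first factor only. In arity 1, \<open>\<tau>\<close> is given by its value at the unit.\<close>

lemma anticyclic_Dias_unique:
  assumes anti: "ns_anticyclic_operad dias_scale Dias dias_unit dias_comp \<tau>"
    and left: "\<tau> 2 dias_left = - dias_right"
    and right: "\<tau> 2 dias_right = dias_left - dias_right"
    and n: "1 \<le> n" and x: "x \<in> Dias n"
  shows "\<tau> n x = dias_tau x"
proof -
  interpret ns_anticyclic_operad dias_scale Dias dias_unit dias_comp \<tau>
    by (rule anti)
  have basis: "\<tau> n (dias_basis n m) = dias_basis n (m - 1) - dias_basis n n"
    if m: "1 \<le> m" "m \<le> n" for m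
  proof (cases "n = 1")
    case True
    then show ?thesis
      using m tau_unit by (simp add: dias_generators_eq_basis)
  next
    case False
    define k where "k = n - 1"
    have k: "n = k + 1" "1 \<le> k"
      using False n by (simp_all add: k_def)
    have gens: "dias_basis 2 1 \<in> Dias 2" "dias_basis 2 2 \<in> Dias 2"
      by (simp_all add: dias_basis_in_Dias)
    have tau_2: "\<tau> 2 (dias_basis 2 1) = - dias_basis 2 2"
      "\<tau> 2 (dias_basis 2 2) = dias_basis 2 1 - dias_basis 2 2"
      using left right by (simp_all only: dias_generators_eq_basis)
    have tau_comp_2: "\<tau> n (dias_comp f 2 (dias_basis k j)) =
        dias_comp (\<tau> 2 f) 1 (dias_basis k j)" if "f \<in> Dias 2" "j \<le> k" for f j
      using tau_comp[of 2 2 k f "dias_basis k j"] that k by (simp add: dias_basis_in_Dias)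
    show ?thesis
    proof (cases "m = 1")
      case True
      have "dias_comp (dias_basis 2 1) 2 (dias_basis k 1) = dias_basis n m"
        using k True by (subst dias_comp_basis) auto
      moreover have "dias_comp (dias_basis 2 2) 1 (dias_basis k 1) = dias_basis n n"
        using k by (subst dias_comp_basis) auto
      ultimately show ?thesis
        using tau_comp_2[OF gens(1), of 1] k True
        by (simp only: tau_2 dias_comp_minus_left) simp
    next
      case False
      have "dias_comp (dias_basis 2 2) 2 (dias_basis k (m - 1)) = dias_basis n m"
        "dias_comp (dias_basis 2 1) 1 (dias_basis k (m - 1)) = dias_basis n (m - 1)"
        "dias_comp (dias_basis 2 2) 1 (dias_basis k (m - 1)) = dias_basis n n"
        using k m False by (subst dias_comp_basis; auto)+
      then show ?thesis
        using tau_comp_2[OF gens(2), of "m - 1"] k m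
        by (simp only: tau_2 dias_comp_diff_left)
    qed
  qed
  have tau_0: "\<tau> n 0 = 0"
    using tau_scale[OF n x, of 0] by simp
  from x show ?thesis
    by (induction x rule: Dias_induct)
       (simp_all add: basis dias_tau_basis tau_0 tau_add[OF n] tau_scale[OF n] dias_tau_add
          dias_tau_scale)
qed

theorem theorem3p1:
  shows "\<exists>!\<tau>. \<tau> \<in> (\<Pi>\<^sub>E n\<in>{1..}. Dias n \<rightarrow>\<^sub>E Dias n) \<and>
    (\<forall>x\<in>Dias 1. \<tau> 1 x = - x) \<and>
    \<tau> 2 dias_left = - dias_right \<and>
    \<tau> 2 dias_right = dias_left - dias_right \<and>
    ns_anticyclic_operad dias_scale Dias dias_unit dias_comp \<tau>"
proof -
  define T where "T = (\<lambda>n\<in>{1::nat..}. \<lambda>x\<in>Dias n. dias_tau x)"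
  have T: "T n x = dias_tau x" if "1 \<le> n" "x \<in> Dias n" for n x
    using that by (simp add: T_def)
  have gens: "dias_left \<in> Dias 2" "dias_right \<in> Dias 2"
    by (simp_all add: dias_generators_eq_basis dias_basis_in_Dias)
  show ?thesis
  proof (rule ex1I[of _ T], intro conjI)
    show "T \<in> (\<Pi>\<^sub>E n\<in>{1..}. Dias n \<rightarrow>\<^sub>E Dias n)"
      by (auto simp: T_def dias_tau_in)
    show "\<forall>x\<in>Dias 1. T 1 x = - x"
    proof
      fix x assume x: "x \<in> Dias 1"
      then have "dias_tau x = - x"
        by (induction x rule: Dias_induct)
           (simp_all add: dias_tau_basis dias_tau_add dias_tau_scale le_antisym)
      then show "T 1 x = - x"
        using x by (simp only: T[OF order_refl])
    qed
    show "T 2 dias_left = - dias_right" "T 2 dias_right = dias_left - dias_right"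
      using gens by (simp_all add: T) (simp_all add: dias_generators_eq_basis dias_tau_basis)
    show "ns_anticyclic_operad dias_scale Dias dias_unit dias_comp T"
      by (rule ns_anticyclic_operad_Dias[OF T])
  next
    fix \<tau>
    assume tau: "\<tau> \<in> (\<Pi>\<^sub>E n\<in>{1..}. Dias n \<rightarrow>\<^sub>E Dias n) \<and>
      (\<forall>x\<in>Dias 1. \<tau> 1 x = - x) \<and>
      \<tau> 2 dias_left = - dias_right \<and>
      \<tau> 2 dias_right = dias_left - dias_right \<and>
      ns_anticyclic_operad dias_scale Dias dias_unit dias_comp \<tau>"
    then have agree: "\<tau> n x = T n x" if "1 \<le> n" "x \<in> Dias n" for n x
      using that anticyclic_Dias_unique[of \<tau> n x] by (simp add: T)
    show "\<tau> = T"
    proof (rule PiE_ext[OF conjunct1[OF tau]])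
      show T_in: "T \<in> (\<Pi>\<^sub>E n\<in>{1..}. Dias n \<rightarrow>\<^sub>E Dias n)"
        by (auto simp: T_def dias_tau_in)
      show "\<tau> n = T n" if n: "n \<in> {1..}" for n
        by (rule PiE_ext[OF PiE_mem[OF conjunct1[OF tau] n] PiE_mem[OF T_in n]])
           (use n agree in auto)
    qed
  qed
qed

end
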